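(* Let $k\ge 1$, let $\mathbb Z_0=\mathbb Z\setminus\{0\}$, and let $\{\lambda_j\}_{j\in\mathbb Z_0}$ be a sequence of positive real parameters. If there is a positive solution $\{z_j\}_{j\in\mathbb Z_0}$ ($z_j>0$ for all $j$) of the system $$z_1=\lambda_1\left(\frac{1+z_1}{1+\sum_{j\in\mathbb Z_0}z_j}\right)^k,\qquad z_2=\lambda_2\left(\frac{1+z_2}{1+\sum_{j\in\mathbb Z_0}z_j}\right)^k,\qquad z_i=\lambda_i\left(\frac{1}{1+\sum_{j\in\mathbb Z_0}z_j}\right)^k,\quad i\in\mathbb Z_0\setminus\{1,2\},$$ then both series $\sum_{j\in\mathbb Z_0}z_j$ and $\sum_{j\in\mathbb Z_0}\lambda_j$ converge.
   Context: A priori the sum $\sum_{j\in\mathbb Z_0}z_j$ of positive terms may equal $+\infty$, in which case the right-hand sides of the system are interpreted as $0$. *)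

theory Defs
  imports "HOL-Analysis.Analysis"
begin

definition Z0 :: "int set" where
  "Z0 = UNIV - {0}"

text \<open>The sum is taken in \<open>[0, \<infinity>]\<close>, where it always exists for nonnegative \<open>z\<close>.\<close>

definition total :: "(int \<Rightarrow> real) \<Rightarrow> ennreal" where
  "total z = (\<Sum>\<^sub>\<infinity>j\<in>Z0. ennreal (z j))"

definition numer :: "(int \<Rightarrow> real) \<Rightarrow> int \<Rightarrow> real" where
  "numer z i = (if i = 1 \<or> i = 2 then 1 + z i else 1)"

text \<open>
  The exponent \<open>k\<close> is an arbitrary real number; the base of the power is positive whenever
  \<open>z\<close> is, so for integer \<open>k\<close> this is the ordinary power.
\<close>

definition rhs :: "real \<Rightarrow> (int \<Rightarrow> real) \<Rightarrow> (int \<Rightarrow> real) \<Rightarrow> int \<Rightarrow> real" where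
  "rhs k lam z i =
     (if total z = \<infinity> then 0
      else lam i * (numer z i / (1 + enn2real (total z))) powr k)"

definition positive_solution :: "real \<Rightarrow> (int \<Rightarrow> real) \<Rightarrow> (int \<Rightarrow> real) \<Rightarrow> bool" where
  "positive_solution k lam z \<longleftrightarrow> (\<forall>i\<in>Z0. z i > 0 \<and> z i = rhs k lam z i)"

end

theory Submission
  imports Defs
begin

text \<open>If the sum of the \<open>z j\<close> were infinite, every right-hand side would be 0,
  contradicting positivity; so the total is finite, and
  \<open>summable_on_if_infsum_ennreal_finite\<close> turns this into real summability. With D > 0
  denoting one plus the total, each equation then bounds \<open>lam i\<close> by the fixed multiple
  D^k of \<open>z i\<close>, and comparison finishes.\<close>

lemma summable_on_if_infsum_ennreal_finite:
  fixes f :: "'a \<Rightarrow> real"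
  assumes nonneg: "\<And>x. x \<in> A \<Longrightarrow> f x \<ge> 0"
    and finite: "(\<Sum>\<^sub>\<infinity>x\<in>A. ennreal (f x)) \<noteq> \<infinity>"
  shows "f summable_on A"
proof (rule nonneg_bdd_above_summable_on)
  show "bdd_above (sum f ` {F. F \<subseteq> A \<and> finite F})"
  proof (rule bdd_aboveI2)
    fix F
    assume "F \<in> {F. F \<subseteq> A \<and> finite F}"
    then have F: "F \<subseteq> A" "finite F"
      by auto
    have "ennreal (sum f F) = (\<Sum>x\<in>F. ennreal (f x))"
      using F nonneg by (subst sum_ennreal) auto
    \<comment> \<open>In \<open>ennreal\<close> the infinite sum is the supremum of the finite
      partial sums.\<close>
    also have "\<dots> \<le> (\<Sum>\<^sub>\<infinity>x\<in>A. ennreal (f x))"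
      using F by (subst nonneg_infsum_complete) (auto intro!: SUP_upper)
    \<comment> \<open>Finiteness is essential here: \<open>enn2real\<close> sends \<infinity> to
      0.\<close>
    also have "\<dots> = ennreal (enn2real (\<Sum>\<^sub>\<infinity>x\<in>A. ennreal (f x)))"
      using finite by (simp add: less_top)
    finally show "sum f F \<le> enn2real (\<Sum>\<^sub>\<infinity>x\<in>A. ennreal (f x))"
      by simp
  qed
qed (use nonneg in auto)

theorem lemma2:
  fixes k :: real and lam z :: "int \<Rightarrow> real"
  assumes "k \<ge> 1"
    and "\<And>j. j \<in> Z0 \<Longrightarrow> lam j > 0"
    and "positive_solution k lam z"
  shows "z summable_on Z0 \<and> lam summable_on Z0"
proof
  have pos: "z i > 0" and eq: "z i = rhs k lam z i" if "i \<in> Z0" for i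
    using assms(3) that by (auto simp: positive_solution_def)
  \<comment> \<open>One index suffices: an infinite total would force
    \<open>z 1 = 0\<close>.\<close>
  have finite: "total z \<noteq> \<infinity>"
    using pos[of 1] eq[of 1] by (auto simp: rhs_def Z0_def)
  show z: "z summable_on Z0"
    using finite pos
    by (intro summable_on_if_infsum_ennreal_finite) (auto simp: total_def less_imp_le)
  define D where "D = 1 + enn2real (total z)"
  have D: "D > 0"
    by (simp add: D_def add_pos_nonneg)
  \<comment> \<open>Clearing the denominator leaves \<open>lam i\<close> times a power of the
    numerator; that power is at least 1, since the numerator is at least 1 and k is nonnegative.
    This treats the indices 1 and 2 like all others.\<close>
  have bound: "lam i \<le> z i * D powr k" if "i \<in> Z0" for i
  proof -
    have n: "numer z i \<ge> 1"
      using pos[OF that] by (simp add: numer_def)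
    have "z i * D powr k = lam i * numer z i powr k"
      using eq[OF that] finite D n by (simp add: rhs_def D_def[symmetric] powr_divide)
    moreover have "numer z i powr k \<ge> 1"
      using n assms(1) by (intro ge_one_powr_ge_zero) auto
    ultimately show ?thesis
      using assms(2)[OF that] by simp
  qed
  show "lam summable_on Z0"
    using assms(2) bound
    by (intro summable_on_comparison_test[OF summable_on_cmult_left[OF z]]) (auto simp: less_imp_le)
qed

end
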